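(* Let $\pi'=(d'_1,\dots,d'_n)$ and $\pi''=(d''_1,\dots,d''_n)$ be two non-increasing tree degree sequences with $\pi'\triangleleft\pi''$. Then $\xi^{ce}(T^*_{\pi'})\leq \xi^{ce}(T^*_{\pi''})$, where $T^*_{\pi}$ denotes the greedy tree for the degree sequence $\pi$.
   Context: For a vertex $x$ of a connected graph $H$, $d_H(x)$ is its degree and $\varepsilon_H(x)$ its eccentricity; $\xi^{ce}(H)=\sum_{x\in V(H)}\frac{d_H(x)}{\varepsilon_H(x)}$. Majorization: $\pi'\triangleleft\pi''$ means $\sum_{i=1}^{k}d'_i\leq\sum_{i=1}^{k}d''_i$ for all $k\in\{1,\dots,n-1\}$ and $\sum_{i=1}^{n}d'_i=\sum_{i=1}^{n}d''_i$. Greedy tree for a non-increasing tree degree sequence $(d_1,\dots,d_n)$: a rooted tree whose root has degree $d_1$, whose vertices at height $1$ have degrees $d_2,\dots,d_{d_1+1}$, and in general the vertices at height $i>1$ number $\sum_{x \text{ at height } i-1}(d(x)-1)$ and receive the largest remaining degrees (so every degree at height $i$ is at most every degree at height $i-1$); at each level degrees are placed left to right in non-increasing order, and going level by level from left to right, each vertex of down-degree $d$ (the root's down-degree is its degree, any other vertex's is its degree minus one) is joined to the first $d$ not-yet-connected vertices of the next level. *)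

theory Defs
  imports Complex_Main "HOL-Library.Multiset" "Graph_Theory.Graph_Theory"
begin

text \<open>
  Finite simple graphs are symmetric loop-free digraphs (locale \<^locale>\<open>pair_graph\<close>): the
  undirected edge between \<open>u\<close> and \<open>v\<close> is the pair of arcs \<open>(u, v)\<close>, \<open>(v, u)\<close>. Hence the degree of a vertex is its
  \<^const>\<open>out_degree\<close>.
\<close>

definition graph_dist :: "'a pair_pre_digraph \<Rightarrow> 'a \<Rightarrow> 'a \<Rightarrow> nat" where
  "graph_dist G u v = (LEAST k. \<exists>p. pre_digraph.awalk (with_proj G) u p v \<and> length p = k)"

definition eccentricity :: "'a pair_pre_digraph \<Rightarrow> 'a \<Rightarrow> nat" where
  "eccentricity G u = Max (graph_dist G u ` pverts G)"

text \<open>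
  The connective eccentricity index. The one-vertex graph has degree 0 and eccentricity 0;
  its index is 0 because \<open>x / 0 = 0\<close>.
\<close>

definition xi_ce :: "'a pair_pre_digraph \<Rightarrow> real" where
  "xi_ce G = (\<Sum>x\<in>pverts G. real (out_degree (with_proj G) x) / real (eccentricity G x))"

text \<open>
  The library constant \<^const>\<open>tree\<close> forbids directed cycles, so it rejects every symmetric digraph
  with an edge. In the symmetric encoding a cycle of length 2 only runs back and forth along one
  edge; the cycles of the undirected graph are those of length at least 3.
\<close>

definition undirected_tree :: "'a pair_pre_digraph \<Rightarrow> bool" where
  "undirected_tree G \<longleftrightarrow> pair_graph G \<and> Digraph_Component.connected (with_proj G) \<and>
     \<not> (\<exists>p. pre_digraph.cycle (with_proj G) p \<and> length p \<ge> 3)"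

text \<open>Every finite tree is isomorphic to one whose vertices are natural numbers.\<close>

definition tree_degree_sequence :: "nat list \<Rightarrow> bool" where
  "tree_degree_sequence d \<longleftrightarrow> (\<exists>G :: nat pair_pre_digraph. undirected_tree G \<and>
     mset d = image_mset (out_degree (with_proj G)) (mset_set (pverts G)))"

definition majorized :: "nat list \<Rightarrow> nat list \<Rightarrow> bool" (infix \<open>\<lhd>\<^sub>m\<close> 50) where
  "d' \<lhd>\<^sub>m d'' \<longleftrightarrow> length d' = length d'' \<and>
     (\<forall>k\<in>{1..length d' - 1}. (\<Sum>i<k. d' ! i) \<le> (\<Sum>i<k. d'' ! i)) \<and>
     (\<Sum>i<length d'. d' ! i) = (\<Sum>i<length d''. d'' ! i)"

text \<open>
  The greedy tree of a non-increasing degree sequence \<open>d\<close>. Its vertices are numbered from 0 in the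
  order in which they receive their degrees: level by level, from left to right, so that vertex \<open>v\<close>
  receives degree \<open>d ! v\<close>. Since \<open>d\<close> is non-increasing, each level receives the largest remaining
  degrees, in non-increasing order. Level \<open>h\<close> is an interval of numbers starting at
  \<open>level_start d h\<close>.
\<close>

definition down_degree :: "nat list \<Rightarrow> nat \<Rightarrow> nat" where
  "down_degree d v = (if v = 0 then d ! v else d ! v - 1)"

fun level_start :: "nat list \<Rightarrow> nat \<Rightarrow> nat" where
  "level_start d 0 = 0"
| "level_start d (Suc 0) = 1"
| "level_start d (Suc (Suc h)) = level_start d (Suc h) +
     (\<Sum>v\<in>{level_start d h..<level_start d (Suc h)}. down_degree d v)"

definition greedy_level :: "nat list \<Rightarrow> nat \<Rightarrow> nat set" where
  "greedy_level d h = {level_start d h..<level_start d (Suc h)}"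

text \<open>
  When the turn of vertex \<open>v\<close> of level \<open>h\<close> comes, the vertices of level \<open>h\<close> to its left have
  been joined to an initial segment of level \<open>Suc h\<close>; \<open>v\<close> is joined to the next
  \<open>down_degree d v\<close> vertices.
\<close>

definition first_child :: "nat list \<Rightarrow> nat \<Rightarrow> nat \<Rightarrow> nat" where
  "first_child d h v = level_start d (Suc h) + (\<Sum>u\<in>{level_start d h..<v}. down_degree d u)"

definition parent_child :: "nat list \<Rightarrow> nat rel" where
  "parent_child d = {(v, w). v < length d \<and> w < length d \<and> (\<exists>h. v \<in> greedy_level d h \<and>
     w \<in> {first_child d h v..<first_child d h v + down_degree d v})}"

definition greedy_tree :: "nat list \<Rightarrow> nat pair_pre_digraph" where
  "greedy_tree d = \<lparr> pverts = {..<length d}, parcs = parent_child d \<union> (parent_child d)\<inverse> \<rparr>"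

end

theory Submission
  imports Defs
begin

text \<open>
  In the breadth-first numbering the children of \<open>v\<close> form the interval from \<open>F v\<close> to \<open>F (v + 1)\<close>, where
  \<open>F m = 1 + \<Sum>\<^bsub>u < m\<^esub> c(u)\<close> sums down-degrees. Hence the closed ball of radius \<open>h\<close> around the root is the
  initial segment of length \<open>F\<^sup>h 1\<close>, and the ball around the edge \<open>{0, 1}\<close> is the initial segment of
  length \<open>F\<^sup>h 2\<close>. Let \<open>r\<^sub>1\<close>, \<open>r\<^sub>2\<close> be the distances to these two centres. One of them is the centre
  of the tree, and the last vertex is as far as possible from both, so
  \<open>ecc v = min (r\<^sub>1 v + r\<^sub>1 (n - 1)) (r\<^sub>2 v + r\<^sub>2 (n - 1) + 1)\<close>.
  This is monotone in \<open>v\<close>. Since \<open>F m = 2 - m + \<Sum>\<^bsub>i < m\<^esub> d\<^sub>i\<close> for \<open>m \<ge> 1\<close>, a majorizing sequence has the larger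
  \<open>F\<close>, hence the larger balls and pointwise smaller eccentricities. Replacing the eccentricities and then,
  by Abel summation against the decreasing weights \<open>1 / ecc\<close>, the degrees only increases the index.
\<close>

section \<open>Degree sums of undirected trees\<close>

lemma (in pair_graph) parcs_sym: "(u, v) \<in> parcs G \<Longrightarrow> (v, u) \<in> parcs G"
  using pair_sym_arcs unfolding symmetric_def sym_def by simp

lemma (in pair_graph) connected_imp_rtrancl:
  assumes "Digraph_Component.connected (with_proj G)" "u \<in> pverts G" "v \<in> pverts G"
  shows "(u, v) \<in> (parcs G)\<^sup>*"
proof -
  have "u \<rightarrow>\<^sup>*\<^bsub>mk_symmetric (with_proj G)\<^esub> v"
    using assms unfolding connected_def strongly_connected_def by auto
  then have "(u, v) \<in> (arcs_ends (mk_symmetric (with_proj G)))\<^sup>*"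
    unfolding reachable_def by (rule rtrancl_on_rtranclI)
  also have "arcs_ends (mk_symmetric (with_proj G)) = parcs G"
    using parcs_sym by (auto simp: parcs_mk_symmetric)
  finally show ?thesis .
qed

lemma rtrancl_crossing:
  assumes "(u, v) \<in> R\<^sup>*" "u \<in> S" "v \<notin> S"
  obtains x y where "(x, y) \<in> R" "x \<in> S" "y \<notin> S"
  using assms by (induction rule: rtrancl_induct) auto

text \<open>A simple path from \<open>u\<close> to \<open>v\<close> inside \<open>S\<close>, closed
  up through \<open>w\<close>, would be a cycle; for distinct \<open>u\<close> and \<open>v\<close>
  it has at least three arcs.\<close>

lemma (in pair_graph) acyclic_unique_neighbour:
  assumes acyc: "\<not> (\<exists>p. cycle p \<and> length p \<ge> 3)"
    and paths: "\<forall>u\<in>S. \<forall>v\<in>S. \<exists>p. apath u p v \<and> set (pawalk_verts u p) \<subseteq> S"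
    and w: "w \<notin> S" and u: "(u, w) \<in> parcs G" "u \<in> S" and v: "(v, w) \<in> parcs G" "v \<in> S"
  shows "u = v"
proof (rule ccontr)
  assume "u \<noteq> v"
  obtain p where p: "apath u p v" "set (pawalk_verts u p) \<subseteq> S" using paths u(2) v(2) by blast
  let ?c = "(w, u) # p @ [(v, w)]"
  have aw: "awalk u p v" and dist: "distinct (pawalk_verts u p)" using p by (auto simp: apath_def)
  have "p \<noteq> []" using aw \<open>u \<noteq> v\<close> by (auto simp: awalk_simps)
  have last: "last (pawalk_verts u p) = v" using aw by (rule awlast_of_awalk) simp
  have vw: "awalk v [(v, w)] w" using v(1) by (auto simp: awalk_simps wellformed')
  have awp: "awalk u (p @ [(v, w)]) w" using aw vw by (rule awalk_appendI)
  then have "pawalk_verts u (p @ [(v, w)]) = pawalk_verts u p @ [w]"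
    using awalk_verts_append[OF awp] last by simp
  moreover have "awalk w ?c w" using awp parcs_sym[OF u(1)]
    by (simp add: awalk_Cons_iff del: awalk_append_iff)
  ultimately have "cycle ?c" unfolding cycle_def using dist p(2) w by (intro exI[of _ w]) auto
  moreover have "length ?c \<ge> 3" using \<open>p \<noteq> []\<close> by (cases p) auto
  ultimately show False using acyc by blast
qed

text \<open>Paths from or to \<open>w\<close> are led through \<open>a\<close>; they stay simple
  because \<open>w\<close> lies outside \<open>S\<close>.\<close>

lemma (in pair_graph) paths_insert:
  assumes paths: "\<forall>u\<in>S. \<forall>v\<in>S. \<exists>p. apath u p v \<and> set (pawalk_verts u p) \<subseteq> S"
    and w: "w \<notin> S" and a: "(a, w) \<in> parcs G" "a \<in> S"
  shows "\<forall>u\<in>insert w S. \<forall>v\<in>insert w S. \<exists>p. apath u p v \<and> set (pawalk_verts u p) \<subseteq> insert w S"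
proof (intro ballI)
  fix u v assume u: "u \<in> insert w S" and v: "v \<in> insert w S"
  consider "u = w" "v = w" | "u = w" "v \<in> S" | "u \<in> S" "v = w" | "u \<in> S" "v \<in> S" using u v by blast
  then show "\<exists>p. apath u p v \<and> set (pawalk_verts u p) \<subseteq> insert w S"
  proof cases
    case 1
    then show ?thesis using a(1) by (intro exI[of _ "[]"]) (auto simp: apath_simps wellformed')
  next
    case 2
    then obtain p where "apath a p v" "set (pawalk_verts a p) \<subseteq> S" using paths a(2) by blast
    then show ?thesis using 2 w parcs_sym[OF a(1)]
      by (intro exI[of _ "(w, a) # p"]) (auto simp: apath_simps)
  next
    case 3
    then obtain p where p: "apath u p a" "set (pawalk_verts u p) \<subseteq> S" using paths a(2) by blast
    then have aw: "awalk u p a" by (simp add: apath_def)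
    have last: "last (pawalk_verts u p) = a" using aw by (rule awlast_of_awalk) simp
    have "awalk a [(a, w)] w" using a(1) by (auto simp: awalk_simps wellformed')
    with aw have awp: "awalk u (p @ [(a, w)]) w" by (rule awalk_appendI)
    then have "pawalk_verts u (p @ [(a, w)]) = pawalk_verts u p @ [w]"
      using awalk_verts_append[OF awp] last by simp
    then show ?thesis using 3 p w awp by (intro exI[of _ "p @ [(a, w)]"]) (auto simp: apath_def)
  next
    case 4
    then show ?thesis using paths by blast
  qed
qed

text \<open>
  A maximal set that is path-connected inside itself and spans exactly \<open>2 |S| - 2\<close> arcs is everything:
  a vertex adjacent to it has a unique neighbour in it.
\<close>

lemma (in pair_graph) tree_card_parcs:
  assumes conn: "Digraph_Component.connected (with_proj G)"
    and acyc: "\<not> (\<exists>p. cycle p \<and> length p \<ge> 3)"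
  shows "card (parcs G) + 2 = 2 * card (pverts G)"
proof -
  define P where "P S \<longleftrightarrow> S \<subseteq> pverts G \<and> S \<noteq> {} \<and>
    (\<forall>u\<in>S. \<forall>v\<in>S. \<exists>p. apath u p v \<and> set (pawalk_verts u p) \<subseteq> S) \<and>
    card (parcs G \<inter> S \<times> S) + 2 = 2 * card S" for S
  have "pverts G \<noteq> {}"
    using conn unfolding connected_def strongly_connected_def by (auto simp: mk_symmetric_def)
  then obtain r where "r \<in> pverts G" by blast
  have "parcs G \<inter> {r} \<times> {r} = {}" using no_loops' by auto
  then have "P {r}" unfolding P_def using \<open>r \<in> pverts G\<close> by (auto simp: apath_simps intro!: exI[of _ "[]"])
  moreover have "\<forall>S. P S \<longrightarrow> card S < Suc (card (pverts G))"
  proof (intro allI impI)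
    fix S assume "P S"
    then have "S \<subseteq> pverts G" unfolding P_def by (rule conjunct1)
    then show "card S < Suc (card (pverts G))" using card_mono[OF pair_finite_verts] by (simp add: less_Suc_eq_le)
  qed
  ultimately obtain S where S: "P S" and max: "\<And>T. P T \<Longrightarrow> card T \<le> card S"
    using ex_has_greatest_nat[of P "{r}" card "Suc (card (pverts G))"] by metis
  note S' = S[unfolded P_def]
  have sub: "S \<subseteq> pverts G" using S' by (elim conjE)
  have paths: "\<forall>u\<in>S. \<forall>v\<in>S. \<exists>p. apath u p v \<and> set (pawalk_verts u p) \<subseteq> S"
    using S' by (elim conjE)
  have ne: "S \<noteq> {}" using S' by (elim conjE)
  have card_S: "card (parcs G \<inter> S \<times> S) + 2 = 2 * card S" using S' by (elim conjE)
  have fin: "finite S" using sub pair_finite_verts by (rule finite_subset)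
  have "S = pverts G"
  proof (rule ccontr)
    assume "S \<noteq> pverts G"
    then obtain x y where xy: "x \<in> S" "y \<in> pverts G" "y \<notin> S" "x \<in> pverts G"
      using sub ne by blast
    obtain a w where a: "(a, w) \<in> parcs G" "a \<in> S" and w: "w \<notin> S"
      by (rule rtrancl_crossing[OF connected_imp_rtrancl[OF conn xy(4,2)] xy(1,3)])
    have uniq: "b = a" if "(b, w) \<in> parcs G" "b \<in> S" for b
      by (rule acyclic_unique_neighbour[OF acyc paths w that a])
    \<comment> \<open>As \<open>a\<close> is the only neighbour of \<open>w\<close> in
      \<open>S\<close>, exactly the two arcs of one edge are new, which preserves the count in
      \<open>P\<close>.\<close>
    have "parcs G \<inter> insert w S \<times> insert w S = insert (a, w) (insert (w, a) (parcs G \<inter> S \<times> S))"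
    proof (intro set_eqI iffI)
      fix e assume e: "e \<in> parcs G \<inter> insert w S \<times> insert w S"
      obtain x y where "e = (x, y)" by (cases e)
      then show "e \<in> insert (a, w) (insert (w, a) (parcs G \<inter> S \<times> S))"
        using e uniq[of x] uniq[of y] parcs_sym[of x y] no_loops'[of w w] by auto
    next
      fix e assume "e \<in> insert (a, w) (insert (w, a) (parcs G \<inter> S \<times> S))"
      then show "e \<in> parcs G \<inter> insert w S \<times> insert w S"
        using a parcs_sym[OF a(1)] by auto
    qed
    moreover have "finite (parcs G \<inter> S \<times> S)" using fin by simp
    moreover have "(a, w) \<notin> insert (w, a) (parcs G \<inter> S \<times> S)" "(w, a) \<notin> parcs G \<inter> S \<times> S"
      using a w by auto
    ultimately have "card (parcs G \<inter> insert w S \<times> insert w S) = card (parcs G \<inter> S \<times> S) + 2"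
      by simp
    then have "P (insert w S)"
      unfolding P_def using sub card_S w fin wellformed'(2)[OF a(1)]
      by (intro conjI paths_insert[OF paths w a]) simp_all
    then show False using max[of "insert w S"] w fin by simp
  qed
  moreover have "parcs G \<inter> pverts G \<times> pverts G = parcs G" using wellformed' by auto
  ultimately show ?thesis using card_S by simp
qed

lemma (in pair_fin_digraph) sum_out_degree: "(\<Sum>v\<in>pverts G. out_degree (with_proj G) v) = card (parcs G)"
proof -
  have "parcs G = (\<Union>v\<in>pverts G. out_arcs (with_proj G) v)" using in_arcsD1 by auto
  moreover have "card (\<Union>v\<in>pverts G. out_arcs (with_proj G) v) = (\<Sum>v\<in>pverts G. card (out_arcs (with_proj G) v))"
    using pair_finite_verts by (intro card_UN_disjoint) (auto simp: finite_out_arcs)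
  ultimately show ?thesis by (simp add: out_degree_def)
qed

text \<open>The degrees add up to the number of arcs, which \<open>tree_card_parcs\<close>
  determines.\<close>

lemma tree_degree_sequence_sum:
  assumes "tree_degree_sequence d"
  shows "sum_list d + 2 = 2 * length d"
proof -
  obtain G :: "nat pair_pre_digraph" where G: "undirected_tree G"
    and d: "mset d = image_mset (out_degree (with_proj G)) (mset_set (pverts G))"
    using assms unfolding tree_degree_sequence_def by blast
  interpret pair_graph G using G unfolding undirected_tree_def by simp
  have "sum_list d = (\<Sum>v\<in>pverts G. out_degree (with_proj G) v)"
    by (metis d sum_mset_sum_list sum_unfold_sum_mset)
  moreover have "length d = card (pverts G)" by (metis d size_image_mset size_mset size_mset_set)
  moreover have "card (parcs G) + 2 = 2 * card (pverts G)"
    using G tree_card_parcs unfolding undirected_tree_def by blast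
  ultimately show ?thesis using sum_out_degree by simp
qed

lemma tree_degree_sequence_pos:
  assumes "tree_degree_sequence d" "length d \<ge> 2" "x \<in> set d"
  shows "x \<ge> 1"
proof -
  obtain G :: "nat pair_pre_digraph" where G: "undirected_tree G"
    and d: "mset d = image_mset (out_degree (with_proj G)) (mset_set (pverts G))"
    using assms unfolding tree_degree_sequence_def by blast
  interpret pair_graph G using G unfolding undirected_tree_def by simp
  have "x \<in># image_mset (out_degree (with_proj G)) (mset_set (pverts G))"
    using assms(3) by (simp flip: d)
  then obtain v where v: "v \<in> pverts G" "x = out_degree (with_proj G) v" using pair_finite_verts by auto
  have "card (pverts G) \<ge> 2" using assms(2) by (metis d size_image_mset size_mset size_mset_set)
  then have "\<not> pverts G \<subseteq> {v}" using card_mono[of "{v}" "pverts G"] by auto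
  then obtain u where "u \<in> pverts G" "u \<notin> {v}" by blast
  moreover have "Digraph_Component.connected (with_proj G)" using G by (simp add: undirected_tree_def)
  ultimately have "(v, u) \<in> (parcs G)\<^sup>*" using v(1) by (intro connected_imp_rtrancl)
  moreover note \<open>u \<notin> {v}\<close>
  ultimately obtain y where "(v, y) \<in> parcs G" by (cases rule: converse_rtranclE) auto
  then have "(v, y) \<in> out_arcs (with_proj G) v" by simp
  then have "card (out_arcs (with_proj G) v) > 0" using finite_out_arcs by (auto simp only: card_gt_0_iff)
  then show ?thesis using v(2) by (simp add: out_degree_def)
qed

section \<open>Distances and eccentricities\<close>

text \<open>Trades lists of arcs for powers of the arc relation, so that a distance becomes a least
  exponent.\<close>

lemma (in pair_wf_digraph) awalk_iff_relpow:
  assumes "u \<in> pverts G"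
  shows "(\<exists>p. awalk u p v \<and> length p = k) \<longleftrightarrow> (u, v) \<in> parcs G ^^ k"
  using assms
proof (induction k arbitrary: u)
  case 0
  then show ?case by (auto simp: awalk_simps)
next
  case (Suc k)
  have "(\<exists>p. awalk u p v \<and> length p = Suc k) \<longleftrightarrow>
      (\<exists>x. (u, x) \<in> parcs G \<and> (\<exists>p. awalk x p v \<and> length p = k))"
  proof
    assume "\<exists>p. awalk u p v \<and> length p = Suc k"
    then obtain e p where "awalk u (e # p) v" "length p = k" by (auto simp: length_Suc_conv)
    then show "\<exists>x. (u, x) \<in> parcs G \<and> (\<exists>p. awalk x p v \<and> length p = k)"
      by (cases e) (auto simp: awalk_Cons_iff)
  next
    assume "\<exists>x. (u, x) \<in> parcs G \<and> (\<exists>p. awalk x p v \<and> length p = k)"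
    then obtain x p where "(u, x) \<in> parcs G" "awalk x p v" "length p = k" by blast
    then have "awalk u ((u, x) # p) v" "length ((u, x) # p) = Suc k" by (simp_all add: awalk_Cons_iff)
    then show "\<exists>p. awalk u p v \<and> length p = Suc k" by blast
  qed
  also have "\<dots> \<longleftrightarrow> (\<exists>x. (u, x) \<in> parcs G \<and> (x, v) \<in> parcs G ^^ k)"
    using Suc.IH in_arcsD2 by blast
  also have "\<dots> \<longleftrightarrow> (u, v) \<in> parcs G ^^ Suc k"
    using relpow_Suc_D2 relpow_Suc_I2 by metis
  finally show ?case .
qed

lemma (in pair_wf_digraph) graph_dist_eq:
  "u \<in> pverts G \<Longrightarrow> graph_dist G u v = (LEAST k. (u, v) \<in> parcs G ^^ k)"
  unfolding graph_dist_def by (simp add: awalk_iff_relpow)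

lemma (in pair_fin_digraph) eccentricity_le:
  assumes u: "u \<in> pverts G" and walk: "\<And>v. v \<in> pverts G \<Longrightarrow> \<exists>k\<le>m. (u, v) \<in> parcs G ^^ k"
  shows "eccentricity G u \<le> m"
  unfolding eccentricity_def
proof (rule Max.boundedI)
  fix x assume "x \<in> graph_dist G u ` pverts G"
  then obtain v where v: "v \<in> pverts G" "x = graph_dist G u v" by blast
  then obtain k where "k \<le> m" "(u, v) \<in> parcs G ^^ k" using walk by blast
  then show "x \<le> m" using v u Least_le[of "\<lambda>k. (u, v) \<in> parcs G ^^ k" k]
    by (simp add: graph_dist_eq)
qed (use u pair_finite_verts in auto)

text \<open>The source of lower bounds on distances; the potential used later is
  \<open>signed_depth\<close>.\<close>

lemma relpow_lipschitz:
  fixes f :: "'a \<Rightarrow> int"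
  assumes "\<And>x y. (x, y) \<in> R \<Longrightarrow> \<bar>f x - f y\<bar> \<le> 1" "(u, v) \<in> R ^^ k"
  shows "\<bar>f u - f v\<bar> \<le> int k"
  using assms(2)
proof (induction k arbitrary: v)
  case (Suc k)
  then obtain w where w: "(u, w) \<in> R ^^ k" "(w, v) \<in> R" by auto
  show ?case using Suc.IH[OF w(1)] assms(1)[OF w(2)] by linarith
qed simp

lemma (in pair_fin_digraph) eccentricity_ge:
  fixes f :: "'a \<Rightarrow> int"
  assumes u: "u \<in> pverts G" and w: "w \<in> pverts G" and walk: "(u, w) \<in> parcs G ^^ k"
    and lip: "\<And>x y. (x, y) \<in> parcs G \<Longrightarrow> \<bar>f x - f y\<bar> \<le> 1"
  shows "\<bar>f u - f w\<bar> \<le> int (eccentricity G u)"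
proof -
  \<comment> \<open>The given walk may have any length: it only guarantees that the
    \<open>LEAST\<close> is attained.\<close>
  have "(u, w) \<in> parcs G ^^ graph_dist G u w"
    unfolding graph_dist_eq[OF u] using walk by (rule LeastI)
  with lip have "\<bar>f u - f w\<bar> \<le> int (graph_dist G u w)" by (rule relpow_lipschitz)
  also have "graph_dist G u w \<le> eccentricity G u"
    unfolding eccentricity_def using w pair_finite_verts by (intro Max_ge) auto
  finally show ?thesis by simp
qed

lemma relpow_sym: "sym R \<Longrightarrow> (u, v) \<in> R ^^ k \<Longrightarrow> (v, u) \<in> R ^^ k"
proof (induction k arbitrary: v)
  case (Suc k)
  then obtain w where "(u, w) \<in> R ^^ k" "(w, v) \<in> R" by auto
  then have "(v, w) \<in> R" "(w, u) \<in> R ^^ k" using Suc by (auto dest: symD)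
  then show ?case by (rule relpow_Suc_I2)
qed simp

section \<open>Breadth-first numbering of the greedy tree\<close>

text \<open>The map \<open>F\<close> of the overview: the root and the children of the vertices
  before \<open>m\<close> are numbered first. In contrast to \<open>first_child\<close>, no level is
  mentioned.\<close>

definition child_start :: "nat list \<Rightarrow> nat \<Rightarrow> nat" where
  "child_start d m = Suc (\<Sum>u<m. down_degree d u)"

text \<open>
  For \<open>c = 1\<close> and \<open>c = 2\<close> this is the distance from \<open>v\<close> to the set \<open>{..<c}\<close>. It is meaningful only for
  \<open>v < n\<close>, since the iterates never exceed the number of vertices \<open>n\<close>.
\<close>

definition level_rank :: "nat list \<Rightarrow> nat \<Rightarrow> nat \<Rightarrow> nat" where
  "level_rank d c v = (LEAST h. v < (child_start d ^^ h) c)"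

lemma child_start_0 [simp]: "child_start d 0 = 1"
  by (simp add: child_start_def)

lemma child_start_Suc: "child_start d (Suc m) = child_start d m + down_degree d m"
  by (simp add: child_start_def)

lemma child_start_mono: "k \<le> m \<Longrightarrow> child_start d k \<le> child_start d m"
  unfolding child_start_def by (simp add: sum_mono2)

lemma child_start_split:
  assumes "k \<le> m"
  shows "child_start d m = child_start d k + (\<Sum>u\<in>{k..<m}. down_degree d u)"
proof -
  have "{..<m} = {..<k} \<union> {k..<m}" using assms by auto
  then show ?thesis unfolding child_start_def by (simp add: sum.union_disjoint ivl_disj_int)
qed

text \<open>Both parts are proved together: the inequality allows splitting the sum in
  \<open>child_start\<close> at a level boundary, and the level sums telescope.\<close>

lemma level_start_Suc: "level_start d h \<le> level_start d (Suc h) \<and>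
  level_start d (Suc h) = child_start d (level_start d h)"
proof (induction h)
  case (Suc h)
  then have "level_start d (Suc (Suc h)) = child_start d (level_start d (Suc h))"
    using child_start_split[of "level_start d h" "level_start d (Suc h)" d] by simp
  with Suc show ?case by (metis child_start_mono)
qed simp

lemma level_start_eq: "level_start d h = (child_start d ^^ h) 0"
  by (induction h) (auto simp: level_start_Suc simp del: level_start.simps(3))

lemma first_child_eq: "v \<in> greedy_level d h \<Longrightarrow> first_child d h v = child_start d v"
  using child_start_split[of "level_start d h" v d] level_start_Suc[of d h]
  by (simp add: first_child_def greedy_level_def)

text \<open>The numerical content of a tree degree sequence. Two vertices make all degrees positive
  and provide the edge between 0 and 1.\<close>

locale tree_sequence =
  fixes d :: "nat list" and n :: nat
  assumes len: "length d = n" and sorted: "sorted_wrt (\<ge>) d" and two_le: "2 \<le> n"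
    and sum_d: "sum_list d + 2 = 2 * n" and pos: "\<And>i. i < n \<Longrightarrow> 1 \<le> d ! i"
begin

section \<open>Growth of \<open>F\<close> and its iterates\<close>

abbreviation F :: "nat \<Rightarrow> nat" where "F \<equiv> child_start d"

lemma antimono: "i \<le> j \<Longrightarrow> j < n \<Longrightarrow> d ! j \<le> d ! i"
  using sorted_wrt_nth_less[OF sorted, of i j] len by (cases "i = j") auto

text \<open>Each vertex but the root has down-degree one below its degree. This is the link from
  majorization to \<open>F\<close>, in additive form to avoid truncated subtraction.\<close>

lemma F_add:
  assumes "1 \<le> m" "m \<le> n"
  shows "F m + m = (\<Sum>i<m. d ! i) + 2"
  using assms
proof (induction m)
  case (Suc m)
  show ?case
  proof (cases "m = 0")
    case True
    then show ?thesis by (simp add: child_start_Suc down_degree_def)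
  next
    case False
    then show ?thesis using Suc pos[of m] by (simp add: child_start_Suc down_degree_def)
  qed
qed simp

lemma F_n [simp]: "F n = n"
proof -
  have "sum_list d = (\<Sum>i<n. d ! i)" using len by (simp add: sum_list_sum_nth atLeast0LessThan)
  then show ?thesis using F_add[of n] sum_d two_le by simp
qed

lemma F_le: "m \<le> n \<Longrightarrow> F m \<le> n"
  using child_start_mono[of m n d] by simp

text \<open>Degrees do not increase, so a leaf is followed only by leaves.\<close>

lemma F_leaf:
  assumes "1 \<le> m" "m < n" "down_degree d m = 0"
  shows "F m = n"
proof -
  have "down_degree d u = 0" if "u \<in> {m..<n}" for u
    using that assms antimono[of m u] by (simp add: down_degree_def)
  then show ?thesis using child_start_split[of m n d] assms by simp
qed

text \<open>If \<open>m\<close> has a child, so has every earlier vertex, which gives at least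
  \<open>m\<close> children besides the root; if \<open>m > 0\<close> is a leaf,
  \<open>F_leaf\<close> applies. Hence the iterates grow until they reach \<open>n\<close>.\<close>

lemma F_gt:
  assumes "m < n"
  shows "m < F m"
proof (cases "m = 0 \<or> down_degree d m = 0")
  case True
  then show ?thesis using F_leaf[of m] assms by (cases "m = 0") auto
next
  case False
  then have "down_degree d u \<ge> 1" if "u < m" for u
    using that assms antimono[of u m] by (auto simp: down_degree_def)
  then have "(\<Sum>u<m. 1) \<le> (\<Sum>u<m. down_degree d u)" by (intro sum_mono) auto
  then show ?thesis by (simp add: child_start_def)
qed

lemma F_less:
  assumes "1 \<le> k" "k < m" "F k < n"
  shows "F k < F m"
proof -
  have "k < n" using assms child_start_mono[of n k d] by (cases "k < n") auto
  then have "down_degree d k \<noteq> 0" using F_leaf assms by force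
  then have "F k < F (Suc k)" by (simp add: child_start_Suc)
  also have "\<dots> \<le> F m" using assms child_start_mono by simp
  finally show ?thesis .
qed

lemma F_one_ge: "2 \<le> F 1"
  using pos[of 0] two_le by (simp add: child_start_Suc down_degree_def)

lemma iter_le: "c \<le> n \<Longrightarrow> (F ^^ h) c \<le> n"
  by (induction h) (auto simp: F_le)

lemma iter_Suc_ge: "c \<le> n \<Longrightarrow> (F ^^ h) c \<le> (F ^^ Suc h) c"
  using iter_le[of c h] F_gt[of "(F ^^ h) c"] by (cases "(F ^^ h) c = n") auto

lemma iter_mono: "c \<le> n \<Longrightarrow> h \<le> k \<Longrightarrow> (F ^^ h) c \<le> (F ^^ k) c"
  using lift_Suc_mono_le[of "\<lambda>h. (F ^^ h) c"] iter_Suc_ge by blast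

lemma iter_ge: "c \<le> n \<Longrightarrow> min n (c + h) \<le> (F ^^ h) c"
proof (induction h)
  case (Suc h)
  then show ?case using iter_le[of c h] F_gt[of "(F ^^ h) c"] by (cases "(F ^^ h) c = n") auto
qed simp

text \<open>The iterates increase and reach \<open>n\<close> within \<open>n\<close> steps, so the
  \<open>LEAST\<close> exists. Ranks are compared through this equivalence from here on.\<close>

lemma level_rank_le_iff:
  assumes "c \<le> n" "v < n"
  shows "level_rank d c v \<le> h \<longleftrightarrow> v < (F ^^ h) c"
proof
  have "v < (F ^^ n) c" using iter_ge[OF assms(1), of n] assms(2) by simp
  then have "v < (F ^^ level_rank d c v) c" unfolding level_rank_def by (rule LeastI)
  then show "v < (F ^^ h) c" if "level_rank d c v \<le> h"
    using that iter_mono[OF assms(1) that] by simp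
  show "level_rank d c v \<le> h" if "v < (F ^^ h) c"
    unfolding level_rank_def using that by (rule Least_le)
qed

lemma level_rank_mono: "c \<le> n \<Longrightarrow> u \<le> v \<Longrightarrow> v < n \<Longrightarrow> level_rank d c u \<le> level_rank d c v"
  using level_rank_le_iff[of c u "level_rank d c v"] level_rank_le_iff[of c v "level_rank d c v"] by simp

lemma level_rank_0: "v < c \<Longrightarrow> level_rank d c v = 0"
  unfolding level_rank_def by simp

section \<open>The parent relation without levels\<close>

definition edge :: "nat \<Rightarrow> nat \<Rightarrow> bool" where
  "edge v w \<longleftrightarrow> w < n \<and> F v \<le> w \<and> w < F (Suc v)"

lemma edge_less: "edge v w \<Longrightarrow> v < w"
  using F_gt[of v] child_start_mono[of n v d] by (cases "v < n") (auto simp: edge_def)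

text \<open>Since \<open>w < F m\<close> iff \<open>v < m\<close>, the child is captured exactly one
  application of \<open>F\<close> after its parent. The bound \<open>c \<le> w\<close> excludes rank
  0 for the child.\<close>

lemma level_rank_child:
  assumes c: "c \<le> n" "c \<le> w" and e: "edge v w"
  shows "level_rank d c w = Suc (level_rank d c v)"
proof -
  have w: "w < n" and v: "v < n" using e edge_less[OF e] by (auto simp: edge_def)
  have "w < F m \<longleftrightarrow> v < m" for m
    using e child_start_mono[of m v d] child_start_mono[of "Suc v" m d]
    by (cases "v < m") (auto simp: edge_def)
  then have iff: "level_rank d c w \<le> Suc h \<longleftrightarrow> level_rank d c v \<le> h" for h
    by (simp add: level_rank_le_iff c v w)
  moreover have "level_rank d c w \<noteq> 0" using level_rank_le_iff[OF c(1) w, of 0] c(2) by simp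
  ultimately show ?thesis
    by (metis le_antisym not_less_eq_eq order_refl not0_implies_Suc)
qed

lemma parent_exists:
  assumes "1 \<le> w" "w < n"
  obtains v where "edge v w"
proof -
  \<comment> \<open>The child intervals tile the numbers from 1 to \<open>n - 1\<close>; this
    \<open>k\<close> is one past the parent.\<close>
  define k where "k = (LEAST k. w < F k)"
  have "w < F k" unfolding k_def using assms by (intro LeastI[of "\<lambda>k. w < F k" n]) simp
  moreover from this have "k \<noteq> 0" using assms by (cases k) auto
  moreover from this have "\<not> w < F (k - 1)" unfolding k_def by (intro not_less_Least[of _ "\<lambda>k. w < F k"]) simp
  ultimately have "edge (k - 1) w" using assms by (simp add: edge_def)
  then show ?thesis by (rule that)
qed

lemma parent_unique: "edge u w \<Longrightarrow> edge v w \<Longrightarrow> u = v"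
  using child_start_mono[of "Suc u" v d] child_start_mono[of "Suc v" u d]
  by (cases u v rule: linorder_cases) (auto simp: edge_def)

lemma edge_one: "edge v 1 \<longleftrightarrow> v = 0"
  using edge_less[of v 1] F_one_ge two_le by (auto simp: edge_def)

lemma parent_child_eq: "parent_child d = {(v, w). edge v w}"
proof -
  have "(v, w) \<in> parent_child d \<longleftrightarrow> edge v w" for v w
  proof
    assume "(v, w) \<in> parent_child d"
    then show "edge v w"
      by (auto simp: parent_child_def edge_def first_child_eq child_start_Suc len)
  next
    assume e: "edge v w"
    then have v: "v < n" "w < n" using edge_less[of v w] by (auto simp: edge_def)
    \<comment> \<open>Iterating from 0 takes one step to capture the root, so the rank counted from
      0 exceeds the level by one.\<close>
    have "v < (F ^^ level_rank d 0 v) 0" "level_rank d 0 v \<noteq> 0"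
      using level_rank_le_iff[of 0 v "level_rank d 0 v"] level_rank_le_iff[of 0 v 0] v by simp_all
    moreover from this have "\<not> v < (F ^^ (level_rank d 0 v - 1)) 0"
      using level_rank_le_iff[of 0 v "level_rank d 0 v - 1"] v by linarith
    ultimately have lev: "v \<in> greedy_level d (level_rank d 0 v - 1)"
      unfolding greedy_level_def level_start_eq by simp
    then show "(v, w) \<in> parent_child d"
      using e v first_child_eq[OF lev] by (auto simp: parent_child_def edge_def child_start_Suc len)
  qed
  then show ?thesis by auto
qed

section \<open>The greedy tree as a graph\<close>

definition T :: "nat pair_pre_digraph" where "T = greedy_tree d"

lemma pverts_T: "pverts T = {..<n}"
  by (simp add: T_def greedy_tree_def len)

lemma parcs_T: "(u, v) \<in> parcs T \<longleftrightarrow> edge u v \<or> edge v u"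
  by (simp add: T_def greedy_tree_def parent_child_eq)

lemma sym_parcs: "sym (parcs T)"
  by (rule symI) (auto simp: parcs_T)

lemma fin_T: "pair_fin_digraph T"
proof
  have lt: "u < n \<and> v < n" if "edge u v" for u v
    using that edge_less[OF that] by (simp add: edge_def)
  show verts: "fst e \<in> pverts T" "snd e \<in> pverts T" if "e \<in> parcs T" for e
    using that lt by (cases e; auto simp: parcs_T pverts_T)+
  show "finite (pverts T)" by (simp add: pverts_T)
  then show "finite (parcs T)"
    using verts by (intro finite_subset[of "parcs T" "pverts T \<times> pverts T"]) (auto simp: mem_Times_iff)
qed

text \<open>The unique parent of a non-root vertex restores the 1 subtracted in
  \<open>down_degree\<close>.\<close>

lemma out_degree_T:
  assumes v: "v < n"
  shows "out_degree (with_proj T) v = d ! v"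
proof -
  have eq: "out_arcs (with_proj T) v = Pair v ` ({F v..<F (Suc v)} \<union> {u. edge u v})"
  proof -
    have "w < n" if "w < F (Suc v)" for w using that F_le[of "Suc v"] v by simp
    then show ?thesis by (auto simp: out_arcs_def parcs_T edge_def)
  qed
  have "card (out_arcs (with_proj T) v) = card ({F v..<F (Suc v)} \<union> {u. edge u v})"
    unfolding eq by (intro card_image inj_onI) simp
  also have "\<dots> = card {F v..<F (Suc v)} + card {u. edge u v}"
  proof (rule card_Un_disjoint)
    have "{u. edge u v} \<subseteq> {..<v}" using edge_less by auto
    then show "finite {u. edge u v}" by (rule finite_subset) simp
    show "{F v..<F (Suc v)} \<inter> {u. edge u v} = {}" using edge_less F_gt[OF v] by fastforce
  qed simp
  also have "card {F v..<F (Suc v)} = down_degree d v" by (simp add: child_start_Suc)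
  also have "card {u. edge u v} = (if v = 0 then 0 else 1)"
  proof (cases "v = 0")
    case True
    then have "{u. edge u v} = {}" using edge_less by auto
    then show ?thesis using True by simp
  next
    case False
    then obtain u where "edge u v" using parent_exists[of v] v by auto
    then have "{u. edge u v} = {u}" using parent_unique by auto
    then show ?thesis using False by simp
  qed
  also have "down_degree d v + (if v = 0 then 0 else 1) = d ! v"
    using pos[OF v] by (simp add: down_degree_def)
  finally show ?thesis by (simp add: out_degree_def)
qed

subsection \<open>Eccentricities in the greedy tree\<close>

abbreviation depth :: "nat \<Rightarrow> nat" where "depth \<equiv> level_rank d 1"
abbreviation depth2 :: "nat \<Rightarrow> nat" where "depth2 \<equiv> level_rank d 2"

text \<open>Each passage to the parent lowers the rank by one, until the central set
  \<open>{..<c}\<close> is reached.\<close>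

lemma walk_to_root:
  assumes "1 \<le> c" "c \<le> n" "v < n"
  shows "\<exists>r<c. (v, r) \<in> parcs T ^^ level_rank d c v"
  using assms(3)
proof (induction v rule: less_induct)
  case (less v)
  show ?case
  proof (cases "v < c")
    case True
    then show ?thesis by (auto simp: level_rank_0)
  next
    case False
    then obtain u where u: "edge u v" using parent_exists[of v] less.prems assms by auto
    have "u < n" using edge_less[OF u] less.prems by simp
    with less.IH[OF edge_less[OF u]] obtain r where r: "r < c" "(u, r) \<in> parcs T ^^ level_rank d c u"
      by blast
    have "(v, u) \<in> parcs T" using u by (simp add: parcs_T)
    then have "(v, r) \<in> parcs T ^^ Suc (level_rank d c u)" using r(2) by (intro relpow_Suc_I2)
    moreover have "level_rank d c v = Suc (level_rank d c u)"
      using False by (intro level_rank_child assms(2) u) simp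
    ultimately have "(v, r) \<in> parcs T ^^ level_rank d c v" by (simp only:)
    then show ?thesis using r(1) by blast
  qed
qed

lemma walk_depth:
  assumes "u < n" "v < n"
  shows "(u, v) \<in> parcs T ^^ (depth u + depth v)"
proof -
  have u: "(u, 0) \<in> parcs T ^^ depth u" and v: "(v, 0) \<in> parcs T ^^ depth v"
    using walk_to_root[of 1 u] walk_to_root[of 1 v] assms by (simp_all add: less_one)
  show ?thesis unfolding relpow_add using u relpow_sym[OF sym_parcs v] by (rule relcompI)
qed

lemma walk_depth2:
  assumes "u < n" "v < n"
  shows "\<exists>k\<le>depth2 u + depth2 v + 1. (u, v) \<in> parcs T ^^ k"
proof -
  obtain r where r: "r < 2" "(u, r) \<in> parcs T ^^ depth2 u"
    using walk_to_root[OF _ two_le assms(1)] by (meson one_le_numeral)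
  obtain s where s: "s < 2" "(v, s) \<in> parcs T ^^ depth2 v"
    using walk_to_root[OF _ two_le assms(2)] by (meson one_le_numeral)
  \<comment> \<open>The two walks may arrive at different ends of the central edge; crossing it
    costs the extra 1.\<close>
  obtain k where k: "k \<le> 1" "(r, s) \<in> parcs T ^^ k"
  proof (cases "r = s")
    case True
    then show ?thesis using that[of 0] by simp
  next
    case False
    then have "(r, s) \<in> parcs T"
      using r(1) s(1) edge_one[of 0] by (auto simp: parcs_T less_2_cases_iff)
    then show ?thesis using that[of 1] by simp
  qed
  have "(u, v) \<in> parcs T ^^ (depth2 u + (k + depth2 v))"
    unfolding relpow_add using r(2) k(2) relpow_sym[OF sym_parcs s(2)] by (intro relcompI)
  then show ?thesis using k(1) by (intro exI[of _ "depth2 u + (k + depth2 v)"]) simp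
qed

definition ecc :: "nat \<Rightarrow> nat" where
  "ecc v = min (depth v + depth (n - 1)) (depth2 v + depth2 (n - 1) + 1)"

lemma eccentricity_le_ecc:
  assumes v: "v < n"
  shows "eccentricity T v \<le> ecc v"
proof -
  interpret pair_fin_digraph T by (rule fin_T)
  have "eccentricity T v \<le> depth v + depth (n - 1)"
  proof (rule eccentricity_le)
    fix u assume "u \<in> pverts T"
    then have "u < n" by (simp add: pverts_T)
    then show "\<exists>k\<le>depth v + depth (n - 1). (v, u) \<in> parcs T ^^ k"
      using walk_depth[OF v, of u] level_rank_mono[of 1 u "n - 1"]
      by (intro exI[of _ "depth v + depth u"]) auto
  qed (simp add: pverts_T v)
  moreover have "eccentricity T v \<le> depth2 v + depth2 (n - 1) + 1"
  proof (rule eccentricity_le)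
    fix u assume "u \<in> pverts T"
    then have "u < n" by (simp add: pverts_T)
    then obtain k where "k \<le> depth2 v + depth2 u + 1" "(v, u) \<in> parcs T ^^ k"
      using walk_depth2[OF v] by blast
    moreover have "depth2 u \<le> depth2 (n - 1)"
      using \<open>u < n\<close> two_le by (intro level_rank_mono) auto
    ultimately show "\<exists>k\<le>depth2 v + depth2 (n - 1) + 1. (v, u) \<in> parcs T ^^ k"
      by (intro exI[of _ k]) simp
  qed (simp add: pverts_T v)
  ultimately show ?thesis by (simp add: ecc_def)
qed

lemma depth_0 [simp]: "level_rank d (Suc 0) 0 = 0" "depth2 0 = 0" "depth2 (Suc 0) = 0"
  by (simp_all add: level_rank_0)

lemma depth_1 [simp]: "level_rank d (Suc 0) (Suc 0) = 1"
  using level_rank_child[of 1 1 0] two_le edge_one by simp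

text \<open>Monotonicity of \<open>F\<close> carries \<open>1 \<le> 2 \<le> F 1\<close> along.
  Consequently the two depths of a vertex differ by at most one.\<close>

lemma iter_interlace: "(F ^^ h) 1 \<le> (F ^^ h) 2" "(F ^^ h) 2 \<le> (F ^^ Suc h) 1"
proof (induction h)
  case 0
  { case 1 show ?case by simp }
  { case 2 show ?case using F_one_ge by simp }
next
  case (Suc h)
  { case 1 show ?case using Suc.IH(1) child_start_mono by simp }
  { case 2 show ?case using Suc.IH(2) child_start_mono by simp }
qed

lemma depth2_le: "v < n \<Longrightarrow> depth2 v \<le> depth v"
  using level_rank_le_iff[of 1 v "depth v"] level_rank_le_iff[of 2 v "depth v"]
    iter_interlace(1)[of "depth v"] two_le by simp

lemma depth_le: "v < n \<Longrightarrow> depth v \<le> Suc (depth2 v)"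
  using level_rank_le_iff[of 1 v "Suc (depth2 v)"] level_rank_le_iff[of 2 v "depth2 v"]
    iter_interlace(2)[of "depth2 v"] two_le by simp

text \<open>
  The vertices with \<open>depth2 v < depth v\<close> are the descendants of vertex 1, itself included. Giving their
  depth a negative sign measures distances between that branch and the rest of the tree.
\<close>

definition signed_depth :: "nat \<Rightarrow> int" where
  "signed_depth v = (if depth2 v < depth v then - int (depth v) else int (depth v))"

text \<open>On an edge to a child other than 1 both depths rise by one, so the sign rule is the same
  at both ends; from 0 to 1 the value drops from 0 to -1.\<close>

lemma signed_depth_lipschitz:
  assumes "(u, v) \<in> parcs T"
  shows "\<bar>signed_depth u - signed_depth v\<bar> \<le> 1"
proof -
  have *: "\<bar>signed_depth u - signed_depth v\<bar> \<le> 1" if e: "edge u v" for u v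
  proof (cases "v = 1")
    case True
    then have "u = 0" using e edge_one by simp
    then show ?thesis using True by (simp add: signed_depth_def)
  next
    case False
    then have "2 \<le> v" using edge_less[OF e] by simp
    then show ?thesis using level_rank_child[of 1 v u] level_rank_child[of 2 v u] e two_le
      by (simp add: signed_depth_def)
  qed
  show ?thesis using assms *[of u v] *[of v u] by (auto simp: parcs_T abs_minus_commute)
qed

lemma signed_depth_le_eccentricity:
  assumes "v < n" "w < n"
  shows "\<bar>signed_depth v - signed_depth w\<bar> \<le> int (eccentricity T v)"
proof -
  interpret pair_fin_digraph T by (rule fin_T)
  show ?thesis
    using assms by (intro eccentricity_ge[OF _ _ walk_depth] signed_depth_lipschitz) (auto simp: pverts_T)
qed

text \<open>\<open>F_less\<close> carries \<open>1 < 2\<close> along. Thus the first vertex at depth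
  \<open>h + 1\<close>, numbered \<open>(F ^^ h) 1\<close>, descends from vertex 1.\<close>

lemma iter_less: "(F ^^ h) 1 < n \<Longrightarrow> (F ^^ h) 1 < (F ^^ h) 2"
proof (induction h)
  case (Suc h)
  have "1 \<le> (F ^^ h) 1" using iter_mono[of 1 0 h] two_le by simp
  moreover have "(F ^^ h) 1 < n" using Suc.prems iter_Suc_ge[of 1 h] two_le by simp
  ultimately show ?case using F_less[of "(F ^^ h) 1" "(F ^^ h) 2"] Suc by simp
qed simp

text \<open>Provides a vertex at depth \<open>h + 1\<close> outside the branch of vertex 1, whenever
  a deeper level exists.\<close>

lemma iter_less': "(F ^^ Suc h) 1 < n \<Longrightarrow> (F ^^ h) 2 < (F ^^ Suc h) 1"
proof (induction h)
  case 0
  then have F1: "F 1 < n" by simp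
  have "2 < F 1"
  \<comment> \<open>A root of degree 1 forces degree 1 on vertex 1, which leaves \<open>F\<close>
    stuck at 2 although \<open>n > 2\<close>.\<close>
  proof (rule ccontr)
    assume "\<not> 2 < F 1"
    then have "F 1 = 2" using F_one_ge by simp
    then have "down_degree d 0 = 1" "2 < n" using F1 by (simp_all add: child_start_Suc)
    then have "d ! 1 \<le> 1" using antimono[of 0 1] by (simp add: down_degree_def)
    then have "F 2 = F 1" by (simp add: child_start_Suc down_degree_def numeral_2_eq_2)
    then show False using F_gt[of 2] \<open>F 1 = 2\<close> \<open>2 < n\<close> by simp
  qed
  then show ?case by simp
next
  case (Suc h)
  have "1 \<le> (F ^^ h) 2" using iter_mono[of 2 0 h] two_le by simp
  moreover have "(F ^^ Suc h) 1 < n" using Suc.prems iter_Suc_ge[of 1 "Suc h"] two_le by simp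
  moreover have "F ((F ^^ h) 2) < n"
    using Suc.prems child_start_mono[OF iter_interlace(2)[of h], of d] by simp
  ultimately show ?case using F_less[of "(F ^^ h) 2" "(F ^^ Suc h) 1"] Suc by simp
qed

lemma depth_last_pos: "1 \<le> depth (n - 1)"
  using level_rank_mono[of 1 1 "n - 1"] two_le by simp

text \<open>A distant vertex is needed across the edge between 0 and 1: at depth \<open>H\<close>
  or, if \<open>v\<close> descends from 1 and the deepest level lies wholly in that branch, at depth
  \<open>H - 1\<close>.\<close>

lemma ecc_le_eccentricity:
  assumes v: "v < n"
  shows "ecc v \<le> eccentricity T v"
proof -
  define H where "H = depth (n - 1)"
  have H: "1 \<le> H" using depth_last_pos by (simp add: H_def)
  have dlast: "n - 1 < (F ^^ h) c \<longleftrightarrow> level_rank d c (n - 1) \<le> h" if "c \<le> n" for c h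
    using level_rank_le_iff[OF that, of "n - 1"] two_le by simp
  show ?thesis
  proof (cases "depth2 v < depth v")
    case False
    \<comment> \<open>The first vertex of the deepest level, which lies below vertex 1 by
      \<open>iter_less\<close>.\<close>
    define w where "w = (F ^^ (H - 1)) 1"
    have "w \<noteq> n" using dlast[of 1 "H - 1"] H two_le by (auto simp: w_def H_def)
    then have w: "w < n" using iter_le[of 1 "H - 1"] two_le by (simp add: w_def)
    have "\<not> depth w \<le> H - 1" using level_rank_le_iff[OF _ w, of 1 "H - 1"] two_le by (simp add: w_def)
    moreover have "depth w \<le> H" using level_rank_mono[of 1 w "n - 1"] w two_le by (simp add: H_def)
    moreover have "depth2 w \<le> H - 1"
      using level_rank_le_iff[OF _ w, of 2 "H - 1"] iter_less[of "H - 1"] w two_le by (simp add: w_def)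
    ultimately have "signed_depth w = - int H" using H by (simp add: signed_depth_def)
    then show ?thesis using signed_depth_le_eccentricity[OF v w] False
      by (simp add: signed_depth_def ecc_def H_def)
  next
    case branch: True
    then have dv: "depth v = Suc (depth2 v)" using depth_le[OF v] by simp
    show ?thesis
    proof (cases "depth2 (n - 1) < H")
      case False
      have "n - 1 < n" using two_le by simp
      from signed_depth_le_eccentricity[OF v this] False branch show ?thesis
        by (simp add: signed_depth_def ecc_def H_def)
    next
      case True
      \<comment> \<open>The whole deepest level lies in the branch of \<open>v\<close>, so the
        second term of \<open>ecc\<close> saves one step.\<close>
      have ecc: "ecc v \<le> depth v + (H - 1)" using True dv H by (simp add: ecc_def)
      obtain w where w: "w < n" "depth w = H - 1" "depth2 w = H - 1"
      proof (cases "H = 1")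
        case True
        then show ?thesis using that[of 0] two_le by simp
      next
        case False
        define k where "k = H - 2"
        then have k: "H = Suc (Suc k)" using False H by simp
        \<comment> \<open>The last vertex at depth \<open>H - 1\<close>; \<open>iter_less'\<close>
          puts it outside the branch of vertex 1.\<close>
        define w where "w = (F ^^ Suc k) 1 - 1"
        have "(F ^^ Suc k) 1 \<noteq> n" using dlast[of 1 "Suc k"] k two_le by (auto simp: H_def)
        then have less: "(F ^^ Suc k) 1 < n" using iter_le[of 1 "Suc k"] two_le by simp
        then have gt: "(F ^^ k) 2 < (F ^^ Suc k) 1" by (rule iter_less')
        then have w: "w < n" "w < (F ^^ Suc k) 1" "\<not> w < (F ^^ k) 2" using less by (auto simp: w_def)
        then have "depth w \<le> Suc k" "\<not> depth2 w \<le> k"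
          using level_rank_le_iff[of 1 w "Suc k"] level_rank_le_iff[of 2 w k] two_le by simp_all
        then show ?thesis using that[of w] depth2_le[of w] w(1) k by simp
      qed
      then show ?thesis using signed_depth_le_eccentricity[OF v w(1)] branch ecc
        by (simp add: signed_depth_def)
    qed
  qed
qed

lemma xi_ce_T: "xi_ce (greedy_tree d) = (\<Sum>v<n. real (d ! v) / real (ecc v))"
proof -
  have "xi_ce T = (\<Sum>v<n. real (d ! v) / real (ecc v))"
    unfolding xi_ce_def pverts_T
    by (rule sum.cong) (simp_all add: out_degree_T le_antisym[OF eccentricity_le_ecc ecc_le_eccentricity])
  then show ?thesis by (simp add: T_def)
qed

lemma ecc_pos: "1 \<le> ecc v"
  using depth_last_pos by (simp add: ecc_def)

lemma ecc_mono: "u \<le> v \<Longrightarrow> v < n \<Longrightarrow> ecc u \<le> ecc v"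
  using level_rank_mono[of 1 u v] level_rank_mono[of 2 u v] two_le by (auto simp: ecc_def)

end

section \<open>Comparison under majorization\<close>

lemma iter_child_start_mono:
  assumes "tree_sequence d' n" "tree_sequence d'' n" "c \<le> n"
    and le: "\<And>m. m \<le> n \<Longrightarrow> child_start d' m \<le> child_start d'' m"
  shows "(child_start d' ^^ h) c \<le> (child_start d'' ^^ h) c"
proof (induction h)
  case (Suc h)
  have "child_start d' ((child_start d' ^^ h) c) \<le> child_start d'' ((child_start d' ^^ h) c)"
    using tree_sequence.iter_le[OF assms(1,3)] by (rule le)
  also have "\<dots> \<le> child_start d'' ((child_start d'' ^^ h) c)" using Suc by (rule child_start_mono)
  finally show ?case by simp
qed simp

text \<open>A larger \<open>F\<close> gives larger balls, which contain \<open>v\<close> no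
  later.\<close>

lemma level_rank_antimono:
  assumes "tree_sequence d' n" "tree_sequence d'' n" "c \<le> n" "v < n"
    and "\<And>m. m \<le> n \<Longrightarrow> child_start d' m \<le> child_start d'' m"
  shows "level_rank d'' c v \<le> level_rank d' c v"
  using iter_child_start_mono[OF assms(1-3,5), of "level_rank d' c v"]
    tree_sequence.level_rank_le_iff[OF assms(1,3,4), of "level_rank d' c v"]
    tree_sequence.level_rank_le_iff[OF assms(2,3,4), of "level_rank d' c v"] by simp

lemma ecc_antimono:
  assumes "tree_sequence d' n" "tree_sequence d'' n" "v < n"
    and "\<And>m. m \<le> n \<Longrightarrow> child_start d' m \<le> child_start d'' m"
  shows "tree_sequence.ecc d'' n v \<le> tree_sequence.ecc d' n v"
proof -
  have "2 \<le> n" using assms(1) by (rule tree_sequence.two_le)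
  then have "level_rank d'' c u \<le> level_rank d' c u" if "u < n" "c \<le> 2" for c u
    using that by (intro level_rank_antimono[OF assms(1,2) _ _ assms(4)]) auto
  from this[of v 1] this[of "n - 1" 1] this[of v 2] this[of "n - 1" 2] show ?thesis
    using assms(3) \<open>2 \<le> n\<close>
    by (auto simp: tree_sequence.ecc_def[OF assms(1)] tree_sequence.ecc_def[OF assms(2)])
qed

text \<open>Keeping the last weight in the bound makes the induction work: a nonnegative partial sum
  permits lowering that weight to the next one.\<close>

lemma abel_sum_ge:
  fixes x g :: "nat \<Rightarrow> real"
  assumes "\<And>k. k \<le> Suc n \<Longrightarrow> 0 \<le> (\<Sum>i<k. x i)" "\<And>i j. i \<le> j \<Longrightarrow> j \<le> n \<Longrightarrow> g j \<le> g i"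
  shows "(\<Sum>i<Suc n. x i) * g n \<le> (\<Sum>i<Suc n. x i * g i)"
  using assms
proof (induction n)
  case (Suc n)
  have "(\<Sum>i<Suc n. x i) * g (Suc n) \<le> (\<Sum>i<Suc n. x i) * g n"
    using Suc.prems(1)[of "Suc n"] Suc.prems(2)[of n "Suc n"] by (intro mult_left_mono) auto
  also have "\<dots> \<le> (\<Sum>i<Suc n. x i * g i)" using Suc.prems by (intro Suc.IH) auto
  finally show ?case by (simp add: algebra_simps)
qed simp

lemma majorized_sum_le:
  fixes g :: "nat \<Rightarrow> real"
  assumes maj: "\<And>k. k \<le> n \<Longrightarrow> (\<Sum>i<k. d' ! i) \<le> (\<Sum>i<k. d'' ! i)"
    and g: "\<And>i j. i \<le> j \<Longrightarrow> j < n \<Longrightarrow> g j \<le> g i" and nonneg: "\<And>i. 0 \<le> g i"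
  shows "(\<Sum>i<n. real (d' ! i) * g i) \<le> (\<Sum>i<n. real (d'' ! i) * g i)"
proof (cases n)
  case (Suc m)
  define x where "x i = real (d'' ! i) - real (d' ! i)" for i
  have x: "0 \<le> (\<Sum>i<k. x i)" if "k \<le> n" for k
    using maj[OF that] unfolding x_def sum_subtractf by (simp flip: of_nat_sum)
  then have "0 \<le> (\<Sum>i<n. x i) * g m" using nonneg by simp
  also have "\<dots> \<le> (\<Sum>i<n. x i * g i)" using abel_sum_ge[of m x g] x g Suc by simp
  also have "\<dots> = (\<Sum>i<n. real (d'' ! i) * g i) - (\<Sum>i<n. real (d' ! i) * g i)"
    by (simp add: x_def sum_subtractf left_diff_distrib)
  finally show ?thesis by simp
qed simp

theorem theorem3p11:
  fixes d' d'' :: "nat list" and n :: nat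
  assumes "length d' = n" and "length d'' = n"
    and "sorted_wrt (\<ge>) d'" and "sorted_wrt (\<ge>) d''"
    and "tree_degree_sequence d'" and "tree_degree_sequence d''"
    and "d' \<lhd>\<^sub>m d''"
  shows "xi_ce (greedy_tree d') \<le> xi_ce (greedy_tree d'')"
proof (cases "n \<ge> 2")
  case False
  \<comment> \<open>A list with at most one entry is determined by its length and sum.\<close>
  have "sum_list d' = sum_list d''"
    using assms(1,2,7) by (simp add: majorized_def sum_list_sum_nth atLeast0LessThan)
  moreover have "length d' \<le> 1" "length d'' = length d'" using False assms(1,2) by auto
  ultimately have "d' = d''" by (cases d'; cases d'') auto
  then show ?thesis by simp
next
  case True
  have ts: "tree_sequence d n" if "length d = n" "sorted_wrt (\<ge>) d" "tree_degree_sequence d" for d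
    using that True tree_degree_sequence_sum[OF that(3)] tree_degree_sequence_pos[OF that(3)]
    by unfold_locales auto
  interpret P: tree_sequence d' n using ts assms by blast
  interpret Q: tree_sequence d'' n using ts assms by blast
  have maj: "(\<Sum>i<k. d' ! i) \<le> (\<Sum>i<k. d'' ! i)" if "k \<le> n" for k
  \<comment> \<open>\<open>majorized\<close> states the inequality for \<open>k\<close> from 1 to
    \<open>n - 1\<close>; at \<open>n\<close> the totals agree.\<close>
  proof (cases "k = 0 \<or> k = n")
    case True
    then show ?thesis using assms(1,2,7) by (auto simp: majorized_def)
  next
    case False
    then have "k \<in> {1..length d' - 1}" using that assms(1) by auto
    then show ?thesis using assms(7) unfolding majorized_def by blast
  qed
  have "child_start d' m \<le> child_start d'' m" if "m \<le> n" for m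
    using P.F_add[OF _ that] Q.F_add[OF _ that] maj[OF that] by (cases "m = 0") auto
  then have ecc_le: "Q.ecc v \<le> P.ecc v" if "v < n" for v
    using that by (intro ecc_antimono P.tree_sequence_axioms Q.tree_sequence_axioms)
  have "xi_ce (greedy_tree d') = (\<Sum>v<n. real (d' ! v) / real (P.ecc v))" by (rule P.xi_ce_T)
  also have "\<dots> \<le> (\<Sum>v<n. real (d' ! v) * (1 / real (Q.ecc v)))"
  proof (rule sum_mono)
    fix v assume "v \<in> {..<n}"
    \<comment> \<open>Positivity of \<open>Q.ecc\<close> matters, since division by 0 would yield
      0.\<close>
    then have "real (d' ! v) / real (P.ecc v) \<le> real (d' ! v) / real (Q.ecc v)"
      using ecc_le[of v] Q.ecc_pos[of v] by (intro divide_left_mono) auto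
    then show "real (d' ! v) / real (P.ecc v) \<le> real (d' ! v) * (1 / real (Q.ecc v))" by simp
  qed
  also have "\<dots> \<le> (\<Sum>v<n. real (d'' ! v) * (1 / real (Q.ecc v)))"
    using maj Q.ecc_mono Q.ecc_pos
    by (intro majorized_sum_le) (auto intro!: divide_left_mono simp: Suc_le_eq)
  also have "\<dots> = xi_ce (greedy_tree d'')" by (simp add: Q.xi_ce_T)
  finally show ?thesis .
qed

end
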